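(* Let $E\subset\mathbb N$ be such that the Gauss IFS $\Phi_E$ is regular, with conformal measure $\mu$. There is a constant $C\ge1$ such that for every $\omega\in E^{\mathbb N}$, $x=\pi(\omega)$, and $r>0$ there exists $n\ge0$ with $[\omega|_{n+1}]\subset B(x,Cr)$ and \[ M(x,n,r)\le\mu(B(x,r))\lesssim M(x,n,Cr),\qquad\text{where } M(x,n,r)=\sum_{\substack{a\in E\\ [(\omega|_n)a]\subset B(x,r)}}\mu((\omega|_n)a), \] the implied constant being independent of $\omega,r,n$.
   Context: For $a\in E$, $\phi_a(x)=1/(a+x)$; $E^*$ finite words; $\phi_\omega=\phi_{\omega_1}\circ\cdots\circ\phi_{\omega_{|\omega|}}$; $\|\phi_\omega'\|=\sup_{[0,1]}|\phi_\omega'|$; cylinder $[\omega]=\phi_\omega([0,1])$; $\omega|_n$ the length-$n$ prefix and $(\omega|_n)a$ its concatenation with the letter $a$. $\pi((a_n))=[0;a_1,a_2,\dots]$. Pressure $\mathrm P_E(s)=\lim_n\frac1n\log\sum_{\omega\in E^n}\|\phi_\omega'\|^s$; regular means $\mathrm P_E(\delta_E)=0$ for some $\delta_E$; the conformal measure is the unique Borel probability measure $\mu$ on $\pi(E^{\mathbb N})$ with $\mu(A)=\sum_{a\in E}\int_{\phi_a^{-1}(A)}|\phi_a'|^{\delta_E}d\mu$. $\mu(\omega)=\mu([\omega])$. *)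

theory Defs
  imports "HOL-Probability.Probability"
begin

definition gauss_map :: "nat \<Rightarrow> real \<Rightarrow> real" where
  "gauss_map a x = 1 / (real a + x)"

definition word_map :: "nat list \<Rightarrow> real \<Rightarrow> real" where
  "word_map w = foldr (\<lambda>a f. gauss_map a \<circ> f) w id"

definition word_deriv_norm :: "nat list \<Rightarrow> real" where
  "word_deriv_norm w = Sup ((\<lambda>x. \<bar>deriv (word_map w) x\<bar>) ` {0..1})"

definition words :: "nat set \<Rightarrow> nat \<Rightarrow> nat list set" where
  "words E n = {w. length w = n \<and> set w \<subseteq> E}"

definition pressure_zero :: "nat set \<Rightarrow> real \<Rightarrow> bool" where
  "pressure_zero E s \<longleftrightarrow>
     (\<forall>n. (\<lambda>w. word_deriv_norm w powr s) summable_on words E n) \<and>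
     ((\<lambda>n. ln (\<Sum>\<^sub>\<infinity>w\<in>words E n. word_deriv_norm w powr s) / real n) \<longlonglongrightarrow> 0)"

definition regular :: "nat set \<Rightarrow> bool" where
  "regular E \<longleftrightarrow> (\<exists>\<delta>. pressure_zero E \<delta>)"

definition cylinder :: "nat list \<Rightarrow> real set" where
  "cylinder w = word_map w ` {0..1}"

definition prefix :: "(nat \<Rightarrow> nat) \<Rightarrow> nat \<Rightarrow> nat list" where
  "prefix \<omega> n = map \<omega> [0..<n]"

text \<open>Coding map pi(omega) = [0; omega_1, omega_2, ...].\<close>
definition coding :: "(nat \<Rightarrow> nat) \<Rightarrow> real" where
  "coding \<omega> = lim (\<lambda>n. word_map (prefix \<omega> n) 0)"

definition limit_set :: "nat set \<Rightarrow> real set" where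
  "limit_set E = coding ` {\<omega>. \<forall>i. \<omega> i \<in> E}"

definition conformal_measure :: "nat set \<Rightarrow> real \<Rightarrow> real measure \<Rightarrow> bool" where
  "conformal_measure E \<delta> \<mu> \<longleftrightarrow>
     prob_space \<mu> \<and> sets \<mu> = sets borel \<and>
     limit_set E \<in> sets \<mu> \<and> emeasure \<mu> (limit_set E) = 1 \<and>
     (\<forall>A \<in> sets borel. emeasure \<mu> A =
        (\<Sum>a. if a \<in> E then
               (\<integral>\<^sup>+ x. indicator {y. gauss_map a y \<in> A} x *
                    ennreal (\<bar>deriv (gauss_map a) x\<bar> powr \<delta>) \<partial>\<mu>)
             else 0))"

definition M_sum :: "nat set \<Rightarrow> real measure \<Rightarrow> (nat \<Rightarrow> nat) \<Rightarrow> nat \<Rightarrow> real \<Rightarrow> ennreal" where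
  "M_sum E \<mu> \<omega> n r =
     (\<Sum>a. if a \<in> E \<and> cylinder (prefix \<omega> n @ [a]) \<subseteq> ball (coding \<omega>) r
           then emeasure \<mu> (cylinder (prefix \<omega> n @ [a])) else 0)"

end

theory Submission
  imports Defs
begin

text \<open>
  Write $q_n$ for the continuants of $\omega$ and choose $n$ with
  $q_{n+1}^{-2} < 72\,r \le q_n^{-2}$. The word map $\phi_w$ of $w = \omega|_n$ is a Moebius map,
  so it has bounded distortion on $[-1/2, 2]$, a neighbourhood of the unit interval, and
  $B(x,r)$ pulls back to points $u$ within $1/8$ of $[0,1]$.
  Points with $u < 0$ or $u > 1$ lie in the cylinder of one further word $v$ on each side: the
  identities $[0;\dots,a] = [0;\dots,a-1,1]$ and $\phi_{w'a}(1+t) = \phi_{w'(a+1)}(t)$ give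
  $\phi_w(u) = \phi_v(-u/(1+u))$ and $\phi_w(u) = \phi_v(u-1)$ respectively, with the continuant
  of $v$ comparable to that of $w$. Conformality then makes $\mu([vb])$ and $\mu([wb])$ comparable
  for every letter $b$, so the mass of $B(x,r)$ outside $[w]$ is also bounded by the children of
  $w$; the child $[wb]$ lies in $B(x,Cr)$ whenever $[wb]$ or $[vb]$ contains a limit point of
  $B(x,r)$.
\<close>

subsection \<open>Word maps and continuants\<close>

lemma word_map_Nil [simp]: "word_map [] t = t"
  by (simp add: word_map_def)

lemma word_map_Cons [simp]: "word_map (a # w) t = 1 / (real a + word_map w t)"
  by (simp add: word_map_def gauss_map_def)

lemma word_map_append: "word_map (v @ w) t = word_map v (word_map w t)"
  by (induction v) simp_all

lemma cylinder_append: "cylinder (v @ w) = word_map v ` cylinder w"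
  by (auto simp: cylinder_def word_map_append image_image)

text \<open>The linear denominator $q_n + t\,q_{n-1}$ of the Moebius map \<^term>\<open>word_map w\<close>;
  its derivative at \<open>t\<close> is $\pm 1$ over the square of this.\<close>
fun denom :: "nat list \<Rightarrow> real \<Rightarrow> real" where
  "denom [] t = 1"
| "denom (a # w) t = (real a + word_map w t) * denom w t"

text \<open>Chain rule for Moebius maps: the denominator is a multiplicative cocycle over
  concatenation.\<close>

lemma denom_append: "denom (v @ w) t = denom v (word_map w t) * denom w t"
  by (induction v) (simp_all add: word_map_append)

section \<open>Positivity on the half-line right of -1, and the exact difference formula\<close>

lemma word_map_gt:
  assumes "0 \<notin> set w" "t > -1"
  shows "word_map w t > -1"
  using assms
proof (induction w)
  case (Cons a w)
  then have "word_map w t > -1" "a \<ge> 1" by auto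
  then have "real a + word_map w t > 0" by linarith
  then have "0 < word_map (a # w) t" by simp
  then show ?case by linarith
qed simp

lemma word_map_pos:
  assumes "0 \<notin> set w" "t > 0"
  shows "word_map w t > 0"
  using assms by (induction w) (auto simp: add_pos_pos)

lemma word_map_unit_interval:
  assumes "0 \<notin> set w" "t \<in> {0..1}"
  shows "word_map w t \<in> {0..1}"
  using assms
proof (induction w)
  case (Cons a w)
  then have "word_map w t \<ge> 0" "real a \<ge> 1" by auto
  then have "real a + word_map w t \<ge> 1" by linarith
  then show ?case by (simp add: divide_le_eq)
qed simp

lemma denom_pos:
  assumes "0 \<notin> set w" "t > -1"
  shows "denom w t > 0"
  using assms
proof (induction w)
  case (Cons a w)
  have "a \<noteq> 0" "0 \<notin> set w" using Cons.prems by auto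
  have "word_map w t > -1" using word_map_gt[OF \<open>0 \<notin> set w\<close> Cons.prems(2)] .
  with \<open>a \<noteq> 0\<close> have "real a + word_map w t > 0" by linarith
  with Cons show ?case by simp
qed simp

text \<open>A Moebius map of determinant (-1)^|w| satisfies this identity exactly, so it takes the
  place of mean value estimates. The sign records the orientation of the map.\<close>

lemma word_map_diff:
  assumes "0 \<notin> set w" "s > -1" "t > -1"
  shows "word_map w s - word_map w t = (-1) ^ length w * (s - t) / (denom w s * denom w t)"
  using assms
proof (induction w)
  case (Cons a w)
  have w: "a \<noteq> 0" "0 \<notin> set w" using Cons.prems by auto
  have "word_map w s > -1" "word_map w t > -1"
    using word_map_gt[OF w(2)] Cons.prems by auto
  with w have p: "real a + word_map w s > 0" "real a + word_map w t > 0" by linarith+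
  have d: "denom w s > 0" "denom w t > 0" using denom_pos w Cons.prems by auto
  have "word_map (a # w) s - word_map (a # w) t
      = - (word_map w s - word_map w t) / ((real a + word_map w s) * (real a + word_map w t))"
    using p by (simp add: field_simps)
  also have "\<dots> = - ((-1) ^ length w * (s - t) / (denom w s * denom w t))
      / ((real a + word_map w s) * (real a + word_map w t))"
    using Cons.IH[OF w(2) Cons.prems(2,3)] by simp
  also have "\<dots> = (-1) ^ length (a # w) * (s - t) / (denom (a # w) s * denom (a # w) t)"
    by (simp add: mult.assoc mult.left_commute)
  finally show ?case .
qed simp

lemma abs_word_map_diff:
  assumes "0 \<notin> set w" "s > -1" "t > -1"
  shows "\<bar>word_map w s - word_map w t\<bar> = \<bar>s - t\<bar> / (denom w s * denom w t)"
  using word_map_diff[OF assms] denom_pos[OF assms(1,2)] denom_pos[OF assms(1,3)]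
  by (simp add: abs_mult power_abs)

lemma word_map_inj:
  assumes "0 \<notin> set w" "s > -1" "t > -1" "word_map w s = word_map w t"
  shows "s = t"
  using abs_word_map_diff[OF assms(1-3)] denom_pos[OF assms(1,2)] denom_pos[OF assms(1,3)] assms(4)
  by auto

text \<open>Here \<open>q\<close> and \<open>p\<close> are the consecutive continuants q_n and
  q_{n-1}. The induction runs from the right because appending a letter \<open>a\<close> is the
  continuant recursion: the pair (q, p) becomes (a q + p, q).\<close>

lemma denom_affine:
  assumes "0 \<notin> set w"
  obtains p q where "1 \<le> q" "0 \<le> p" "p \<le> q" "\<And>t. t > -1 \<Longrightarrow> denom w t = q + p * t"
  using assms
proof (induction w arbitrary: thesis rule: rev_induct)
  case Nil
  show ?case by (rule Nil(1)[of 1 0]) auto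
next
  case (snoc a w)
  then obtain p q where pq: "1 \<le> q" "0 \<le> p" "p \<le> q" "\<And>t. t > -1 \<Longrightarrow> denom w t = q + p * t"
    by (metis Un_iff set_append)
  have a: "real a \<ge> 1" using snoc.prems(2) by (cases a) auto
  show ?case
  proof (rule snoc.prems(1)[of "real a * q + p" q])
    show "1 \<le> real a * q + p" using a pq mult_mono[of 1 "real a" 1 q] by linarith
    show "0 \<le> q" using pq by linarith
    show "q \<le> real a * q + p" using a pq mult_right_mono[of 1 "real a" q] by linarith
    fix t :: real assume t: "t > -1"
    with a have at: "real a + t > 0" by linarith
    then have "1 / (real a + t) > -1" by (smt (verit) divide_pos_pos)
    then have "denom (w @ [a]) t = (q + p * (1 / (real a + t))) * (real a + t)"
      using pq(4) by (simp add: denom_append)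
    also have "\<dots> = real a * q + p + q * t" using at by (simp add: field_simps)
    finally show "denom (w @ [a]) t = real a * q + p + q * t" .
  qed
qed

lemma denom_0_ge_1:
  assumes "0 \<notin> set w"
  shows "denom w 0 \<ge> 1"
proof -
  obtain p q where "1 \<le> q" "\<And>t. t > -1 \<Longrightarrow> denom w t = q + p * t"
    using denom_affine[OF assms] by metis
  then show ?thesis by simp
qed

text \<open>Since p lies between 0 and q, the affine form q + p t stays between q/2 (at t = -1/2)
  and 3q (at t = 2). The interval exceeds [0,1] on both sides because a ball around a point of a
  cylinder may overhang it.\<close>

lemma denom_bounds:
  assumes "0 \<notin> set w" "t \<in> {-1/2..2}"
  shows "denom w 0 / 2 \<le> denom w t" "denom w t \<le> 3 * denom w 0"
proof -
  obtain p q where pq: "1 \<le> q" "0 \<le> p" "p \<le> q" "\<And>t. t > -1 \<Longrightarrow> denom w t = q + p * t"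
    using denom_affine[OF assms(1)] by metis
  have t: "-1/2 \<le> t" "t \<le> 2" using assms by auto
  then have e: "denom w t = q + p * t" "denom w 0 = q" using pq(4) by auto
  have "p * (-1/2) \<le> p * t" "p * t \<le> p * 2"
    using t pq(2) by (intro mult_left_mono; simp)+
  then show "denom w 0 / 2 \<le> denom w t" "denom w t \<le> 3 * denom w 0"
    unfolding e using pq by linarith+
qed

lemma denom_0_le_denom:
  assumes "0 \<notin> set w" "t \<ge> 0"
  shows "denom w 0 \<le> denom w t"
proof -
  obtain p q where pq: "1 \<le> q" "0 \<le> p" "p \<le> q" "\<And>t. t > -1 \<Longrightarrow> denom w t = q + p * t"
    using denom_affine[OF assms(1)] by metis
  then show ?thesis using assms by simp
qed

lemma denom_0_append:
  assumes "0 \<notin> set v" "0 \<notin> set w"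
  shows "denom v 0 * denom w 0 \<le> denom (v @ w) 0"
proof -
  have "word_map w 0 \<ge> 0" using word_map_unit_interval[OF assms(2), of 0] by auto
  from denom_0_le_denom[OF assms(1) this] denom_0_ge_1[OF assms(2)]
  show ?thesis by (auto simp: denom_append intro: mult_right_mono)
qed

text \<open>Bounded distortion: both denominators lie between q/2 and 3q, so their product lies
  between q^2/4 and 9 q^2. This is the source of the constants 4 and 9.\<close>

lemma word_map_expansion:
  assumes "0 \<notin> set w" "s \<in> {-1/2..2}" "t \<in> {-1/2..2}"
  shows "\<bar>word_map w s - word_map w t\<bar> \<le> 4 * \<bar>s - t\<bar> / (denom w 0)\<^sup>2"
    and "\<bar>s - t\<bar> / (9 * (denom w 0)\<^sup>2) \<le> \<bar>word_map w s - word_map w t\<bar>"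
proof -
  let ?q = "denom w 0"
  have q: "?q \<ge> 1" by (rule denom_0_ge_1) fact
  note b = denom_bounds[OF assms(1,2)] denom_bounds[OF assms(1,3)]
  have e: "\<bar>word_map w s - word_map w t\<bar> = \<bar>s - t\<bar> / (denom w s * denom w t)"
    using assms by (intro abs_word_map_diff) auto
  have "(?q / 2) * (?q / 2) \<le> denom w s * denom w t"
    using b q by (intro mult_mono) auto
  then have l: "?q\<^sup>2 / 4 \<le> denom w s * denom w t" by (simp add: power2_eq_square)
  have "denom w s * denom w t \<le> (3 * ?q) * (3 * ?q)"
    using b q by (intro mult_mono) auto
  then have u: "denom w s * denom w t \<le> 9 * ?q\<^sup>2" by (simp add: power2_eq_square)
  have "?q\<^sup>2 > 0" "denom w s > 0" "denom w t > 0" using q b by auto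
  have "\<bar>s - t\<bar> / (denom w s * denom w t) \<le> \<bar>s - t\<bar> / (?q\<^sup>2 / 4)"
    using l \<open>?q\<^sup>2 > 0\<close> \<open>denom w s > 0\<close> \<open>denom w t > 0\<close> by (intro divide_left_mono mult_pos_pos) auto
  then show "\<bar>word_map w s - word_map w t\<bar> \<le> 4 * \<bar>s - t\<bar> / ?q\<^sup>2"
    unfolding e by (simp add: mult.commute)
  show "\<bar>s - t\<bar> / (9 * ?q\<^sup>2) \<le> \<bar>word_map w s - word_map w t\<bar>"
    unfolding e using u \<open>?q\<^sup>2 > 0\<close> \<open>denom w s > 0\<close> \<open>denom w t > 0\<close> by (intro divide_left_mono mult_pos_pos) auto
qed

lemma word_map_continuous_on:
  assumes "0 \<notin> set w"
  shows "continuous_on {-1<..} (word_map w)"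
  using assms
proof (induction w)
  case Nil
  then show ?case by (simp add: word_map_def continuous_on_id id_def)
next
  case (Cons a w)
  have "real a + word_map w t \<noteq> 0" if "t > -1" for t
    using word_map_gt[of w t] Cons.prems that by (cases a) auto
  then have "continuous_on {-1<..} (\<lambda>t. 1 / (real a + word_map w t))"
    using Cons by (intro continuous_intros) auto
  moreover have "word_map (a # w) = (\<lambda>t. 1 / (real a + word_map w t))" by auto
  ultimately show ?case by simp
qed

text \<open>Intermediate value argument: moving t by 1/2 either way moves the image by at least
  1/(18 q^2), which exceeds r, so the image of [t - 1/2, t + 1/2] contains the whole ball. The
  expansion bound then gives |u - t| < 9 q^2 r, at most 9/72 = 1/8.\<close>

lemma word_map_covers_ball:
  assumes "0 \<notin> set w" "t \<in> {0..1}" "\<bar>y - word_map w t\<bar> < r" "72 * r \<le> 1 / (denom w 0)\<^sup>2"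
  obtains u where "\<bar>u - t\<bar> < 1/8" "\<bar>u - t\<bar> \<le> 9 * (denom w 0)\<^sup>2 * r" "y = word_map w u"
proof -
  let ?q = "denom w 0" and ?f = "word_map w"
  have q: "?q \<ge> 1" by (rule denom_0_ge_1) fact
  then have q2: "?q\<^sup>2 > 0" by simp
  have r: "r * ?q\<^sup>2 \<le> 1 / 72" using assms(4) q2 by (simp add: field_simps)
  define a b where "a = t - 1/2" "b = t + 1/2"
  have ab: "a \<in> {-1/2..2}" "b \<in> {-1/2..2}" "t \<in> {-1/2..2}" using assms(2) by (auto simp: a_b_def)
  have "1 / (18 * ?q\<^sup>2) \<le> \<bar>?f a - ?f t\<bar>" "1 / (18 * ?q\<^sup>2) \<le> \<bar>?f b - ?f t\<bar>"
    using word_map_expansion(2)[OF assms(1) ab(1,3)] word_map_expansion(2)[OF assms(1) ab(2,3)]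
    by (auto simp: a_b_def)
  moreover have "r < 1 / (18 * ?q\<^sup>2)" using r q2 by (simp add: field_simps)
  ultimately have far: "r < \<bar>?f a - ?f t\<bar>" "r < \<bar>?f b - ?f t\<bar>" by linarith+
  have cont: "continuous_on {a..b} ?f"
    using word_map_continuous_on[OF assms(1)] by (rule continuous_on_subset) (use ab in auto)
  have da: "?f a - ?f t = (-1) ^ length w * (a - t) / (denom w a * denom w t)"
    using ab by (intro word_map_diff assms) auto
  have db: "?f b - ?f t = (-1) ^ length w * (b - t) / (denom w b * denom w t)"
    using ab by (intro word_map_diff assms) auto
  have pos: "denom w a * denom w t > 0" "denom w b * denom w t > 0"
    using ab by (auto intro!: mult_pos_pos denom_pos assms)
  \<comment> \<open>The parity of \<open>length w\<close> decides whether the map increases or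
    decreases, hence which endpoint has its image below \<open>y\<close>.\<close>
  have "\<exists>u\<ge>a. u \<le> b \<and> ?f u = y"
  proof (cases "even (length w)")
    case True
    then have "?f a - ?f t < 0" "?f b - ?f t > 0"
      using pos unfolding da db by (simp_all add: a_b_def divide_neg_pos)
    then have "?f a \<le> y" "y \<le> ?f b" using far assms(3) by linarith+
    then show ?thesis using IVT'[of ?f a y b] cont by (auto simp: a_b_def)
  next
    case False
    then have "?f a - ?f t > 0" "?f b - ?f t < 0"
      using pos unfolding da db by (simp_all add: a_b_def)
    then have "?f b \<le> y" "y \<le> ?f a" using far assms(3) by linarith+
    then show ?thesis using IVT2'[of ?f b y a] cont by (auto simp: a_b_def)
  qed
  then obtain u where u: "u \<ge> a" "u \<le> b" "?f u = y" by auto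
  have "u \<in> {-1/2..2}" using u ab by auto
  from word_map_expansion(2)[OF assms(1) this ab(3)] u(3) assms(3)
  have "\<bar>u - t\<bar> / (9 * ?q\<^sup>2) < r" by linarith
  then have *: "\<bar>u - t\<bar> < 9 * ?q\<^sup>2 * r" using q2 by (simp add: field_simps)
  moreover have "9 * ?q\<^sup>2 * r \<le> 1/8" using r by (simp add: field_simps)
  ultimately show ?thesis using that[of u] u(3) by linarith
qed

text \<open>The image of [0,1] under \<open>v\<close> is also the image under \<open>w\<close> of an
  interval of length between 1/2 and 1. By bounded distortion its length is of order 1/q^2 for
  either denominator; the ratios of the squares are at most 36 and 72, both below 9^2.\<close>

lemma denom_0_comparable:
  assumes "0 \<notin> set v" "0 \<notin> set w" "s \<in> {-1/2..2}" "t \<in> {-1/2..2}"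
    and "word_map v 0 = word_map w s" "word_map v 1 = word_map w t" "\<bar>s - t\<bar> \<in> {1/2..1}"
  shows "denom v 0 \<le> 9 * denom w 0" "denom w 0 \<le> 9 * denom v 0"
proof -
  have p: "denom v 0 \<ge> 1" "denom w 0 \<ge> 1" using assms denom_0_ge_1 by auto
  then have pp: "(denom v 0)\<^sup>2 > 0" "(denom w 0)\<^sup>2 > 0" by simp_all
  have "1 / (9 * (denom v 0)\<^sup>2) \<le> \<bar>word_map v 0 - word_map v 1\<bar>"
       "\<bar>word_map v 0 - word_map v 1\<bar> \<le> 4 / (denom v 0)\<^sup>2"
    using word_map_expansion[OF assms(1), of 0 1] by auto
  note v = this[unfolded assms(5,6)]
  note w = word_map_expansion[OF assms(2-4)]
  have "1 / (9 * (denom v 0)\<^sup>2) \<le> 4 * 1 / (denom w 0)\<^sup>2"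
    using v(1) w(1) assms(7) pp
    by (smt (verit) atLeastAtMost_iff divide_right_mono mult_left_mono)
  then have "(denom w 0)\<^sup>2 \<le> 36 * (denom v 0)\<^sup>2" using pp by (simp add: field_simps)
  also have "\<dots> = (6 * denom v 0)\<^sup>2" by (simp add: power_mult_distrib)
  finally have 1: "denom w 0 \<le> 6 * denom v 0" using p by (auto intro: power2_le_imp_le)
  show "denom w 0 \<le> 9 * denom v 0" using 1 p by linarith
  have "(1/2) / (9 * (denom w 0)\<^sup>2) \<le> 4 / (denom v 0)\<^sup>2"
    using v(2) w(2) assms(7) pp
    by (smt (verit) atLeastAtMost_iff divide_right_mono mult_left_mono)
  then have "(denom v 0)\<^sup>2 \<le> 72 * (denom w 0)\<^sup>2" using pp by (simp add: field_simps)
  also have "\<dots> \<le> (9 * denom w 0)\<^sup>2" by (simp add: power_mult_distrib)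
  finally show "denom v 0 \<le> 9 * denom w 0" using p by (auto intro: power2_le_imp_le)
qed

subsection \<open>Neighbouring words\<close>

text \<open>Points just left of 0 are recoded by the two expansions of a rational number: a last
  letter a > 1 splits into a - 1, 1, and a last letter 1 merges into its predecessor. The words []
  and [1] have no such neighbour, but they send these points outside (0,1), which is why that
  membership is a premise.\<close>

lemma neighbour_left:
  assumes "0 \<notin> set w"
  obtains v where "0 \<notin> set v" "denom v 0 \<le> 9 * denom w 0" "denom w 0 \<le> 9 * denom v 0"
    "\<And>u. u \<in> {-1/2..<0} \<Longrightarrow> word_map w u \<in> {0<..<1} \<Longrightarrow> word_map w u = word_map v (- u / (1 + u))"
proof -
  note witness = that
  have *: thesis
    if v: "0 \<notin> set v" "\<And>u. u \<in> {-1/2..0} \<Longrightarrow> word_map w u = word_map v (- u / (1 + u))" for v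
  proof -
    \<comment> \<open>The substitution -u/(1+u) sends 0 to 0 and -1/2 to 1, so the cylinder of
      \<open>v\<close> is the image of [-1/2, 0] under \<open>w\<close>.\<close>
    have "word_map v 0 = word_map w 0" "word_map v 1 = word_map w (-1/2)"
      using v(2)[of 0] v(2)[of "-1/2"] by auto
    from denom_0_comparable[OF v(1) assms _ _ this] v show ?thesis
      by (intro witness[of v]) auto
  qed
  \<comment> \<open>In the vacuous case \<open>w\<close> itself serves as the neighbour, and the
    comparability of denominators is trivial.\<close>
  have none: thesis if "\<And>u. u \<in> {-1/2..<0} \<Longrightarrow> word_map w u \<notin> {0<..<1}"
    using that assms denom_0_ge_1[OF assms] by (intro witness[of w]) auto
  show ?thesis
  proof (cases w rule: rev_cases)
    case Nil
    then show ?thesis by (intro none) auto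
  next
    case (snoc w' a)
    with assms have a: "a \<noteq> 0" "0 \<notin> set w'" by auto
    show ?thesis
    proof (cases "a = 1")
      case False
      have "1 / (real a + u) = 1 / (real (a - 1) + 1 / (1 + - u / (1 + u)))"
        if "u \<in> {-1/2..0}" for u
      proof -
        have "1 + u > 0" using that by auto
        then have "1 / (1 + - u / (1 + u)) = 1 + u" by (simp add: field_simps)
        then show ?thesis using a by (simp add: of_nat_diff)
      qed
      note key = this
      show ?thesis
      proof (rule *[of "w' @ [a - 1, 1]"])
        show "0 \<notin> set (w' @ [a - 1, 1])" using a False by auto
        show "word_map w u = word_map (w' @ [a - 1, 1]) (- u / (1 + u))" if "u \<in> {-1/2..0}" for u
          using key[OF that] by (simp only: snoc word_map_append word_map_Cons word_map_Nil of_nat_1)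
      qed
    next
      case True
      show ?thesis
      proof (cases w' rule: rev_cases)
        case Nil
        show ?thesis
        proof (rule none)
          fix u :: real assume "u \<in> {-1/2..<0}"
          then show "word_map w u \<notin> {0<..<1}" by (simp add: snoc Nil True divide_less_eq)
        qed
      next
        case (snoc w'' c)
        have "1 / (real c + 1 / (1 + u)) = 1 / (real (c + 1) + - u / (1 + u))"
          if "u \<in> {-1/2..0}" for u
        proof -
          have "1 + u > 0" using that by auto
          then have "1 / (1 + u) = 1 + - u / (1 + u)" by (simp add: field_simps)
          then show ?thesis by simp
        qed
        note key = this
        have w: "w = w'' @ [c, 1]" using \<open>w = w' @ [a]\<close> snoc True by simp
        show ?thesis
        proof (rule *[of "w'' @ [c + 1]"])
          show "0 \<notin> set (w'' @ [c + 1])" using assms w by auto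
          show "word_map w u = word_map (w'' @ [c + 1]) (- u / (1 + u))" if "u \<in> {-1/2..0}" for u
            using key[OF that] by (simp only: w word_map_append word_map_Cons word_map_Nil of_nat_1)
        qed
      qed
    qed
  qed
qed

text \<open>Raising the last letter by one absorbs the shift: a + u = (a + 1) + (u - 1). For the
  empty word the image u > 1 lies outside (0,1), so the claim is vacuous.\<close>

lemma neighbour_right:
  assumes "0 \<notin> set w"
  obtains v where "0 \<notin> set v" "denom v 0 \<le> 9 * denom w 0" "denom w 0 \<le> 9 * denom v 0"
    "\<And>u. u \<in> {1<..2} \<Longrightarrow> word_map w u \<in> {0<..<1} \<Longrightarrow> word_map w u = word_map v (u - 1)"
proof (cases w rule: rev_cases)
  case Nil
  with that[of w] show ?thesis by simp
next
  case (snoc w' a)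
  define v where "v = w' @ [a + 1]"
  have v: "0 \<notin> set v" "\<And>u. word_map w u = word_map v (u - 1)"
    using assms by (auto simp: v_def snoc word_map_append)
  then have "word_map v 0 = word_map w 1" "word_map v 1 = word_map w 2"
    using v(2)[of 1] v(2)[of 2] by auto
  from denom_0_comparable[OF v(1) assms _ _ this] v show ?thesis
    by (intro that[of v]) auto
qed

subsection \<open>Coding and the limit set\<close>

lemma prefix_Suc: "prefix \<omega> (Suc n) = prefix \<omega> n @ [\<omega> n]"
  by (simp add: prefix_def)

lemma prefix_add: "prefix \<omega> (n + k) = prefix \<omega> n @ prefix (\<lambda>i. \<omega> (i + n)) k"
  by (induction k) (simp_all add: prefix_def add.commute)

lemma set_prefix: "set (prefix \<omega> n) \<subseteq> range \<omega>"
  by (auto simp: prefix_def)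

section \<open>Growth of the continuants and the choice of scale\<close>

lemma denom_prefix_mono:
  assumes "0 \<notin> range \<omega>" "m \<le> n"
  shows "denom (prefix \<omega> m) 0 \<le> denom (prefix \<omega> n) 0"
proof -
  have 0: "0 \<notin> set (prefix \<eta> k)" if "0 \<notin> range \<eta>" for \<eta> k
    using set_prefix[of \<eta> k] that by auto
  define \<eta> where "\<eta> = (\<lambda>i. \<omega> (i + m))"
  have \<eta>: "0 \<notin> range \<eta>" using assms by (auto simp: \<eta>_def)
  have "denom (prefix \<omega> m) 0 * 1 \<le> denom (prefix \<omega> m) 0 * denom (prefix \<eta> (n - m)) 0"
    using 0[OF \<eta>] 0[OF assms(1)] denom_0_ge_1
    by (intro mult_left_mono) (auto intro: order_trans[OF zero_le_one])
  also have "\<dots> \<le> denom (prefix \<omega> (m + (n - m))) 0"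
    unfolding prefix_add \<eta>_def[symmetric] using 0 \<eta> assms by (intro denom_0_append) auto
  finally show ?thesis using assms by simp
qed

text \<open>Two letters a, b contribute a factor ab + 1, which is at least 2, and denominators are
  supermultiplicative. A single letter 1 contributes only a factor 1, hence the step of length
  two.\<close>

lemma denom_prefix_ge:
  assumes "0 \<notin> range \<omega>"
  shows "2 ^ n \<le> denom (prefix \<omega> (2 * n)) 0"
proof (induction n)
  case (Suc n)
  let ?v = "[\<omega> (2 * n), \<omega> (Suc (2 * n))]"
  have 0: "0 \<notin> set (prefix \<omega> (2 * n))" "\<omega> (2 * n) \<noteq> 0" "\<omega> (Suc (2 * n)) \<noteq> 0"
    using assms set_prefix[of \<omega> "2 * n"] by (blast, metis rangeI, metis rangeI)
  then have "1 * 1 \<le> real (\<omega> (2 * n)) * real (\<omega> (Suc (2 * n)))"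
    by (intro mult_mono) auto
  with 0 have "2 \<le> denom ?v 0" by (simp add: field_simps)
  then have "2 ^ n * 2 \<le> denom (prefix \<omega> (2 * n)) 0 * denom ?v 0"
    using Suc.IH by (intro mult_mono order_trans[OF _ Suc.IH]) auto
  also have "\<dots> \<le> denom (prefix \<omega> (2 * n) @ ?v) 0"
    using 0 by (intro denom_0_append) auto
  finally show ?case by (simp add: prefix_def)
qed (simp add: prefix_def)

text \<open>Stopping time: \<open>n\<close> is minimal such that the prefix of length n + 1 has
  crossed the scale r. Minimality bounds the prefix of length n only when n > 0; for large r the
  search stops at n = 0, and that case is treated separately later.\<close>

lemma scale_exists:
  assumes "0 \<notin> range \<omega>" "r > 0"
  obtains n where "1 < 72 * r * (denom (prefix \<omega> (Suc n)) 0)\<^sup>2"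
    "n = 0 \<or> 72 * r * (denom (prefix \<omega> n) 0)\<^sup>2 \<le> 1"
proof -
  define P where "P n \<longleftrightarrow> 1 < 72 * r * (denom (prefix \<omega> n) 0)\<^sup>2" for n
  have 0: "0 \<notin> set (prefix \<omega> n)" for n using assms(1) set_prefix[of \<omega> n] by auto
  obtain k where k: "1 / (72 * r) < 2 ^ k" using real_arch_pow[of 2 "1 / (72 * r)"] by auto
  let ?q = "denom (prefix \<omega> (Suc (2 * k))) 0"
  have "?q \<ge> 2 ^ k"
    using denom_prefix_ge[OF assms(1), of k] denom_prefix_mono[OF assms(1), of "2 * k" "Suc (2 * k)"]
    by linarith
  moreover have "?q \<ge> 1" by (rule denom_0_ge_1[OF 0])
  then have "?q * 1 \<le> ?q\<^sup>2" unfolding power2_eq_square by (intro mult_left_mono) auto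
  ultimately have "1 / (72 * r) < ?q\<^sup>2" using k by linarith
  then have ex: "P (Suc (2 * k))" using assms(2) by (simp add: P_def field_simps)
  define n where "n = (LEAST n. P (Suc n))"
  have "P (Suc n)" unfolding n_def by (rule LeastI) (rule ex)
  moreover have "n = 0 \<or> \<not> P n"
    using not_less_Least[of "n - 1" "\<lambda>n. P (Suc n)"] by (cases n) (auto simp: n_def[symmetric])
  ultimately show ?thesis using that by (auto simp: P_def)
qed

text \<open>The definition through \<open>lim\<close> yields a usable value only once convergence is
  known. All later convergents lie in the cylinder of the n-th prefix, whose diameter is at most
  4/q_n^2, so the sequence is Cauchy.\<close>

lemma coding_limit:
  assumes "0 \<notin> range \<omega>"
  shows "(\<lambda>n. word_map (prefix \<omega> n) 0) \<longlonglongrightarrow> coding \<omega>"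
proof -
  have 0: "0 \<notin> set (prefix \<eta> k)" if "0 \<notin> range \<eta>" for \<eta> k
    using set_prefix[of \<eta> k] that by auto
  have close: "\<bar>word_map (prefix \<omega> m) 0 - word_map (prefix \<omega> n) 0\<bar> \<le> 4 / (denom (prefix \<omega> n) 0)\<^sup>2"
    if "n \<le> m" for m n
  proof -
    define \<eta> where "\<eta> = (\<lambda>i. \<omega> (i + n))"
    define s where "s = word_map (prefix \<eta> (m - n)) 0"
    have "0 \<notin> range \<eta>" using assms by (auto simp: \<eta>_def)
    then have s: "s \<in> {0..1}" unfolding s_def by (intro word_map_unit_interval 0) auto
    have "word_map (prefix \<omega> (n + (m - n))) 0 = word_map (prefix \<omega> n) s"
      unfolding prefix_add by (simp add: \<eta>_def s_def word_map_append)
    moreover have "\<bar>word_map (prefix \<omega> n) s - word_map (prefix \<omega> n) 0\<bar>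
        \<le> 4 * \<bar>s - 0\<bar> / (denom (prefix \<omega> n) 0)\<^sup>2"
      using s by (intro word_map_expansion 0 assms) auto
    moreover have "4 * \<bar>s - 0\<bar> / (denom (prefix \<omega> n) 0)\<^sup>2 \<le> 4 / (denom (prefix \<omega> n) 0)\<^sup>2"
      using s by (intro divide_right_mono) auto
    ultimately show ?thesis using that by simp
  qed
  have "Cauchy (\<lambda>n. word_map (prefix \<omega> n) 0)"
  proof (rule metric_CauchyI)
    fix e :: real assume "e > 0"
    obtain k where k: "8 / e < 2 ^ k" using real_arch_pow[of 2 "8 / e"] by auto
    let ?q = "denom (prefix \<omega> (2 * k)) 0"
    have "8 / e < ?q" using k denom_prefix_ge[OF assms, of k] by linarith
    moreover have "?q \<ge> 1" by (intro denom_0_ge_1 0 assms)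
    then have "?q * 1 \<le> ?q\<^sup>2" unfolding power2_eq_square by (intro mult_left_mono) auto
    ultimately have "8 / e < ?q\<^sup>2" by linarith
    then have q: "4 / ?q\<^sup>2 < e / 2" using \<open>e > 0\<close> \<open>?q \<ge> 1\<close> by (simp add: field_simps)
    show "\<exists>M. \<forall>m\<ge>M. \<forall>n\<ge>M. dist (word_map (prefix \<omega> m) 0) (word_map (prefix \<omega> n) 0) < e"
    proof (intro exI allI impI)
      fix m n assume "m \<ge> 2 * k" "n \<ge> 2 * k"
      with close[of "2 * k" m] close[of "2 * k" n] q
      show "dist (word_map (prefix \<omega> m) 0) (word_map (prefix \<omega> n) 0) < e"
        unfolding dist_real_def by linarith
    qed
  qed
  then show ?thesis
    unfolding coding_def by (simp add: Cauchy_convergent_iff convergent_LIMSEQ_iff)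
qed

lemma coding_shift:
  assumes "0 \<notin> range \<omega>"
  shows "coding \<omega> = word_map (prefix \<omega> n) (coding (\<lambda>i. \<omega> (i + n)))"
    and "coding \<omega> \<in> {0<..<1}"
proof -
  have 0: "0 \<notin> set (prefix \<eta> k)" if "0 \<notin> range \<eta>" for \<eta> k
    using set_prefix[of \<eta> k] that by auto
  \<comment> \<open>The limit first lands in the closed interval. Peeling off one letter makes it
    positive, and peeling off one more makes it less than 1.\<close>
  have I: "coding \<eta> \<in> {0..1}" if \<eta>: "0 \<notin> range \<eta>" for \<eta>
  proof (rule closed_sequentially[OF closed_atLeastAtMost _ coding_limit[OF \<eta>]])
    show "word_map (prefix \<eta> n) 0 \<in> {0..1}" for n
      by (intro word_map_unit_interval 0 \<eta>) auto
  qed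
  have shift: "coding \<omega> = word_map (prefix \<omega> n) (coding (\<lambda>i. \<omega> (i + n)))"
    if "0 \<notin> range \<omega>" for \<omega> n
  proof -
    define \<eta> where "\<eta> = (\<lambda>i. \<omega> (i + n))"
    have \<eta>: "0 \<notin> range \<eta>" using that by (auto simp: \<eta>_def)
    have "isCont (word_map (prefix \<omega> n)) (coding \<eta>)"
      using word_map_continuous_on[OF 0[OF that], of n] I[OF \<eta>]
      by (auto simp: continuous_on_eq_continuous_at)
    from isCont_tendsto_compose[OF this coding_limit[OF \<eta>]]
    have "(\<lambda>k. word_map (prefix \<omega> (n + k)) 0) \<longlonglongrightarrow> word_map (prefix \<omega> n) (coding \<eta>)"
      by (simp add: prefix_add \<eta>_def word_map_append)
    moreover have "(\<lambda>k. word_map (prefix \<omega> (n + k)) 0) \<longlonglongrightarrow> coding \<omega>"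
      using LIMSEQ_ignore_initial_segment[OF coding_limit[OF that], of n] by (simp add: add.commute)
    ultimately show ?thesis using LIMSEQ_unique unfolding \<eta>_def by blast
  qed
  show "coding \<omega> = word_map (prefix \<omega> n) (coding (\<lambda>i. \<omega> (i + n)))" by (rule shift) fact
  have first: "coding \<eta> = 1 / (real (\<eta> 0) + coding (\<lambda>i. \<eta> (i + 1)))" if "0 \<notin> range \<eta>" for \<eta>
    using shift[OF that, of 1] by (simp add: prefix_def)
  have pos: "coding \<eta> > 0" if \<eta>: "0 \<notin> range \<eta>" for \<eta>
  proof -
    have "\<eta> 0 \<noteq> 0" using \<eta> by (metis rangeI)
    moreover have "coding (\<lambda>i. \<eta> (i + 1)) \<in> {0..1}" using \<eta> by (intro I) auto
    ultimately show ?thesis unfolding first[OF \<eta>] by simp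
  qed
  have "\<omega> 0 \<noteq> 0" using assms by (metis rangeI)
  moreover have "coding (\<lambda>i. \<omega> (i + 1)) > 0" using assms by (intro pos) auto
  ultimately have "coding \<omega> < 1" unfolding first[OF assms] by (simp add: divide_less_eq)
  with pos[OF assms] show "coding \<omega> \<in> {0<..<1}" by simp
qed

section \<open>Self-similarity of the limit set\<close>

lemma limit_set_unit_interval:
  assumes "0 \<notin> E" "y \<in> limit_set E"
  shows "y \<in> {0<..<1}"
proof -
  obtain \<omega> where "\<And>i. \<omega> i \<in> E" "y = coding \<omega>" using assms(2) by (auto simp: limit_set_def)
  with assms(1) show ?thesis using coding_shift(2)[of \<omega>] by (metis imageE)
qed

lemma limit_setE:
  assumes "0 \<notin> E" "y \<in> limit_set E"
  obtains a y' where "a \<in> E" "y' \<in> limit_set E" "y = 1 / (real a + y')"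
proof -
  obtain \<omega> where \<omega>: "\<And>i. \<omega> i \<in> E" "y = coding \<omega>" using assms(2) by (auto simp: limit_set_def)
  then have "0 \<notin> range \<omega>" using assms(1) by (metis imageE)
  then have "y = 1 / (real (\<omega> 0) + coding (\<lambda>i. \<omega> (i + 1)))"
    using coding_shift(1)[of \<omega> 1] \<omega> by (simp add: prefix_def)
  moreover have "coding (\<lambda>i. \<omega> (i + 1)) \<in> limit_set E" using \<omega> by (auto simp: limit_set_def)
  ultimately show ?thesis using \<omega> that by blast
qed

text \<open>Uniqueness of continued fraction digits. Limit points have tails in the open interval
  (0,1), so the shared endpoints of adjacent cylinders cause no ambiguity.\<close>

lemma limit_set_word_map:
  assumes "0 \<notin> E" "0 \<notin> set w" "u \<in> {0..1}" "word_map w u \<in> limit_set E"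
  shows "set w \<subseteq> E \<and> u \<in> limit_set E"
  using assms
proof (induction w)
  case (Cons a w)
  have w: "a \<noteq> 0" "0 \<notin> set w" using Cons.prems by auto
  let ?v = "word_map w u"
  have v: "?v \<in> {0..1}" using word_map_unit_interval w Cons.prems by blast
  obtain b y where b: "b \<in> E" "y \<in> limit_set E" "1 / (real a + ?v) = 1 / (real b + y)"
    using limit_setE[OF Cons.prems(1,4)] by auto
  have y: "y \<in> {0<..<1}" using limit_set_unit_interval[OF Cons.prems(1) b(2)] .
  have e: "real a + ?v = real b + y" using arg_cong[OF b(3), of inverse] by simp
  have "real a < real (b + 1)" "real b < real (a + 1)" using e v y by auto
  then have "a = b" unfolding of_nat_less_iff by linarith
  moreover from this e b(2) have "?v \<in> limit_set E" by simp
  ultimately show ?case using b(1) Cons.IH[OF Cons.prems(1) w(2) Cons.prems(3)] by simp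
qed simp

subsection \<open>The conformal measure of cylinders\<close>

lemma compact_cylinder:
  assumes "0 \<notin> set w"
  shows "compact (cylinder w)"
  unfolding cylinder_def
  by (rule compact_continuous_image[OF continuous_on_subset[OF word_map_continuous_on[OF assms]]]) auto

lemma cylinder_borel [measurable]: "0 \<notin> set w \<Longrightarrow> cylinder w \<in> sets borel"
  by (intro borel_compact compact_cylinder)

lemma word_map_borel [measurable]: "word_map w \<in> borel_measurable borel"
proof (induction w)
  case Nil
  have "word_map [] = (\<lambda>t. t)" by auto
  then show ?case by simp
next
  case (Cons a w)
  note [measurable] = Cons
  have "word_map (a # w) = (\<lambda>t. 1 / (real a + word_map w t))" by auto
  then show ?case by simp
qed

lemma denom_borel [measurable]: "denom w \<in> borel_measurable borel"
proof (induction w)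
  case Nil
  have "denom [] = (\<lambda>t. 1)" by auto
  then show ?case by simp
next
  case (Cons a w)
  note [measurable] = Cons
  have "denom (a # w) = (\<lambda>t. (real a + word_map w t) * denom w t)" by auto
  then show ?case by simp
qed

text \<open>The exponent may have either sign, which accounts for the absolute value in the
  constant.\<close>

lemma powr_comparable:
  fixes x y c s :: real
  assumes "x > 0" "y > 0" "c \<ge> 1" "x \<le> c * y" "y \<le> c * x"
  shows "x powr s \<le> c powr \<bar>s\<bar> * y powr s"
proof (cases "s \<ge> 0")
  case True
  then have "x powr s \<le> (c * y) powr s" using assms by (intro powr_mono2) auto
  then show ?thesis using assms True by (simp add: powr_mult)
next
  case False
  have "x powr s \<le> (y / c) powr s"
    using assms False by (intro powr_mono2') (auto simp: divide_le_eq mult.commute)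
  also have "\<dots> = c powr (- s) * y powr s"
    using assms by (simp add: powr_divide powr_minus_divide)
  finally show ?thesis using False by simp
qed

section \<open>The conformal measure: support and change of variables\<close>

locale conformal_gauss =
  fixes E :: "nat set" and \<delta> :: real and \<mu> :: "real measure"
  assumes zero_notin: "0 \<notin> E" and conformal: "conformal_measure E \<delta> \<mu>"
begin

sublocale prob_space \<mu>
  using conformal by (simp add: conformal_measure_def)

lemma sets_eq [simp, measurable_cong]: "sets \<mu> = sets borel"
  using conformal by (simp add: conformal_measure_def)

lemma space_eq [simp]: "space \<mu> = UNIV"
  using sets_eq_imp_space_eq[OF sets_eq] by simp

lemma limit_set_borel [measurable]: "limit_set E \<in> sets borel"
  using conformal by (simp add: conformal_measure_def)

lemma AE_limit_set: "AE x in \<mu>. x \<in> limit_set E"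
proof -
  have "emeasure \<mu> (limit_set E) = 1" using conformal by (simp add: conformal_measure_def)
  then have "prob (limit_set E) = 1" by (simp add: emeasure_eq_measure)
  then show ?thesis by (intro AE_prob_1)
qed

lemma AE_unit_interval: "AE x in \<mu>. x \<in> {0<..<1}"
  using AE_limit_set by eventually_elim (rule limit_set_unit_interval[OF zero_notin])

lemma pos_words: "set w \<subseteq> E \<Longrightarrow> 0 \<notin> set w"
  using zero_notin by auto

lemma conformal_gauss_map:
  assumes "A \<in> sets borel"
  shows "emeasure \<mu> A = (\<Sum>a. if a \<in> E then
    (\<integral>\<^sup>+ x. indicator A (1 / (real a + x)) * ennreal ((real a + x) powr (-2 * \<delta>)) \<partial>\<mu>) else 0)"
proof -
  have d: "\<bar>deriv (gauss_map a) x\<bar> powr \<delta> = (real a + x) powr (-2 * \<delta>)" if "x > 0" for x a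
  proof -
    have "(gauss_map a has_field_derivative - 1 / (real a + x)\<^sup>2) (at x)"
      unfolding gauss_map_def using that
      by (auto intro!: derivative_eq_intros simp: power2_eq_square)
    then have "\<bar>deriv (gauss_map a) x\<bar> = (real a + x) powr (-2)"
      using that by (simp add: DERIV_imp_deriv powr_minus_divide)
    then show ?thesis by (simp add: powr_powr)
  qed
  have "(\<integral>\<^sup>+ x. indicator {y. gauss_map a y \<in> A} x * ennreal (\<bar>deriv (gauss_map a) x\<bar> powr \<delta>) \<partial>\<mu>)
     = (\<integral>\<^sup>+ x. indicator A (1 / (real a + x)) * ennreal ((real a + x) powr (-2 * \<delta>)) \<partial>\<mu>)" for a
    using AE_unit_interval
    by (intro nn_integral_cong_AE, eventually_elim) (simp add: d gauss_map_def indicator_def)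
  then show ?thesis using conformal assms by (simp add: conformal_measure_def cong: if_cong)
qed

text \<open>Change of variables along one branch. Conformality is a statement about sets; it is
  turned into an equality of measures, the restriction of mu to the cylinder against a weighted
  push-forward, and then integrated.\<close>

lemma nn_integral_letter:
  assumes "a \<in> E" and [measurable]: "f \<in> borel_measurable borel"
  shows "(\<integral>\<^sup>+ x. indicator (cylinder [a]) x * f x \<partial>\<mu>)
    = (\<integral>\<^sup>+ x. ennreal ((real a + x) powr (-2 * \<delta>)) * f (1 / (real a + x)) \<partial>\<mu>)"
proof -
  have "a \<noteq> 0" using assms(1) zero_notin by metis
  then have [measurable]: "cylinder [a] \<in> sets borel" by (intro cylinder_borel) auto
  define g where "g x = ennreal ((real a + x) powr (-2 * \<delta>))" for x
  have [measurable]: "g \<in> borel_measurable borel" unfolding g_def by measurable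
  \<comment> \<open>For x in the open unit interval only the branch \<open>a\<close> reaches the
    cylinder of \<open>a\<close>, so the conformality sum collapses to one term almost
    everywhere.\<close>
  have mem: "1 / (real b + x) \<in> cylinder [a] \<longleftrightarrow> b = a" if "b \<in> E" "x \<in> {0<..<1}" for b x
  proof
    assume "1 / (real b + x) \<in> cylinder [a]"
    then obtain t where t: "t \<in> {0..1}" "1 / (real b + x) = 1 / (real a + t)"
      by (auto simp: cylinder_def)
    have "real b + x = real a + t" using arg_cong[OF t(2), of inverse] by simp
    then have "real a < real (b + 1)" "real b < real (a + 1)" using t that by auto
    then show "b = a" unfolding of_nat_less_iff by linarith
  qed (use that in \<open>auto simp: cylinder_def image_iff intro!: bexI[of _ x]\<close>)
  have "density \<mu> (indicator (cylinder [a])) = distr (density \<mu> g) borel (\<lambda>x. 1 / (real a + x))"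
  proof (rule measure_eqI)
    fix A assume "A \<in> sets (density \<mu> (indicator (cylinder [a])))"
    then have [measurable]: "A \<in> sets borel" by simp
    have "(\<integral>\<^sup>+ x. indicator (A \<inter> cylinder [a]) (1 / (real b + x)) * ennreal ((real b + x) powr (-2 * \<delta>)) \<partial>\<mu>)
       = (if b = a then \<integral>\<^sup>+ x. g x * indicator A (1 / (real a + x)) \<partial>\<mu> else 0)"
      if "b \<in> E" for b
    proof -
      have "(\<integral>\<^sup>+ x. indicator (A \<inter> cylinder [a]) (1 / (real b + x)) * ennreal ((real b + x) powr (-2 * \<delta>)) \<partial>\<mu>)
        = (\<integral>\<^sup>+ x. (if b = a then g x * indicator A (1 / (real a + x)) else 0) \<partial>\<mu>)"
        using AE_unit_interval
        by (intro nn_integral_cong_AE, eventually_elim)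
           (use mem[OF that] in \<open>auto simp: g_def indicator_def\<close>)
      then show ?thesis by simp
    qed
    then have "emeasure \<mu> (A \<inter> cylinder [a])
        = (\<Sum>b. if b = a then \<integral>\<^sup>+ x. g x * indicator A (1 / (real a + x)) \<partial>\<mu> else 0)"
      using assms(1) by (subst conformal_gauss_map) (auto intro!: suminf_cong)
    also have "\<dots> = (\<integral>\<^sup>+ x. g x * indicator A (1 / (real a + x)) \<partial>\<mu>)"
      by (subst suminf_finite[of "{a}"]) auto
    also have "\<dots> = emeasure (distr (density \<mu> g) borel (\<lambda>x. 1 / (real a + x))) A"
      by (simp add: emeasure_distr emeasure_density vimage_def indicator_def)
    finally show "emeasure (density \<mu> (indicator (cylinder [a]))) A
        = emeasure (distr (density \<mu> g) borel (\<lambda>x. 1 / (real a + x))) A"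
      by (simp add: emeasure_density nn_integral_indicator indicator_inter_arith[symmetric] Int_commute
           flip: indicator_inter_arith)
  qed simp
  then have "(\<integral>\<^sup>+ x. f x \<partial>density \<mu> (indicator (cylinder [a])))
      = (\<integral>\<^sup>+ x. f x \<partial>distr (density \<mu> g) borel (\<lambda>x. 1 / (real a + x)))" by simp
  then show ?thesis by (simp add: nn_integral_density nn_integral_distr g_def)
qed

text \<open>Iterates the one-letter formula from the front. The integrand is generalised because the
  weight of the first letter is absorbed into it before the induction hypothesis is applied.\<close>

lemma nn_integral_word:
  assumes "set w \<subseteq> E" "f \<in> borel_measurable borel"
  shows "(\<integral>\<^sup>+ x. indicator (cylinder w) x * f x \<partial>\<mu>)
    = (\<integral>\<^sup>+ x. ennreal (denom w x powr (-2 * \<delta>)) * f (word_map w x) \<partial>\<mu>)"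
  using assms
proof (induction w arbitrary: f)
  case Nil
  show ?case using AE_unit_interval
    by (intro nn_integral_cong_AE, eventually_elim) (auto simp: cylinder_def image_iff)
next
  case (Cons a w)
  note [measurable] = Cons.prems(2)
  have E: "a \<in> E" "set w \<subseteq> E" and 0: "0 \<notin> set (a # w)" "a \<noteq> 0" "0 \<notin> set w"
    using Cons.prems(1) pos_words[OF Cons.prems(1)] by auto
  note [measurable] = cylinder_borel[OF 0(1)] cylinder_borel[OF 0(3)]
  have cyl: "cylinder (a # w) = (\<lambda>x. 1 / (real a + x)) ` cylinder w"
    by (auto simp: cylinder_def image_image)
  have sub: "cylinder v \<subseteq> {0..1}" if "0 \<notin> set v" for v
    using word_map_unit_interval[OF that] by (auto simp: cylinder_def)
  have "cylinder (a # w) \<subseteq> cylinder [a]"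
    using sub[OF 0(3)] unfolding cyl by (auto simp: cylinder_def)
  then have "(\<integral>\<^sup>+ x. indicator (cylinder (a # w)) x * f x \<partial>\<mu>)
      = (\<integral>\<^sup>+ x. indicator (cylinder [a]) x * (indicator (cylinder (a # w)) x * f x) \<partial>\<mu>)"
    by (intro nn_integral_cong) (auto simp: indicator_def)
  also have "\<dots> = (\<integral>\<^sup>+ x. ennreal ((real a + x) powr (-2 * \<delta>)) *
      (indicator (cylinder (a # w)) (1 / (real a + x)) * f (1 / (real a + x))) \<partial>\<mu>)"
    by (rule nn_integral_letter[OF E(1)]) measurable
  also have "\<dots> = (\<integral>\<^sup>+ x. indicator (cylinder w) x *
      (ennreal ((real a + x) powr (-2 * \<delta>)) * f (1 / (real a + x))) \<partial>\<mu>)"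
  proof (rule nn_integral_cong)
    fix x
    have "1 / (real a + x) \<in> cylinder (a # w) \<longleftrightarrow> x \<in> cylinder w"
    proof
      assume "1 / (real a + x) \<in> cylinder (a # w)"
      then obtain y where "y \<in> cylinder w" "1 / (real a + x) = 1 / (real a + y)"
        unfolding cyl by auto
      with arg_cong[OF this(2), of inverse] show "x \<in> cylinder w" by simp
    qed (auto simp: cyl)
    then show "ennreal ((real a + x) powr (-2 * \<delta>)) *
        (indicator (cylinder (a # w)) (1 / (real a + x)) * f (1 / (real a + x)))
      = indicator (cylinder w) x * (ennreal ((real a + x) powr (-2 * \<delta>)) * f (1 / (real a + x)))"
      by (simp add: indicator_def)
  qed
  also have "\<dots> = (\<integral>\<^sup>+ x. ennreal (denom w x powr (-2 * \<delta>)) *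
      (ennreal ((real a + word_map w x) powr (-2 * \<delta>)) * f (1 / (real a + word_map w x))) \<partial>\<mu>)"
    by (rule Cons.IH[OF E(2)]) measurable
  also have "\<dots> = (\<integral>\<^sup>+ x. ennreal (denom (a # w) x powr (-2 * \<delta>)) * f (word_map (a # w) x) \<partial>\<mu>)"
    using AE_unit_interval
  proof (intro nn_integral_cong_AE, eventually_elim)
    fix x :: real assume "x \<in> {0<..<1}"
    then have "denom w x > 0" "real a + word_map w x > 0"
      using denom_pos[OF 0(3), of x] word_map_pos[OF 0(3), of x] by auto
    then show "ennreal (denom w x powr (-2 * \<delta>)) *
      (ennreal ((real a + word_map w x) powr (-2 * \<delta>)) * f (1 / (real a + word_map w x)))
      = ennreal (denom (a # w) x powr (-2 * \<delta>)) * f (word_map (a # w) x)"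
      by (simp add: powr_mult ennreal_mult' mult_ac)
  qed
  finally show ?case .
qed

lemma emeasure_cylinder_append:
  assumes "set w \<subseteq> E" "0 \<notin> set u"
  shows "emeasure \<mu> (cylinder (w @ u))
    = (\<integral>\<^sup>+ x. ennreal (denom w x powr (-2 * \<delta>)) * indicator (cylinder u) x \<partial>\<mu>)"
proof -
  have 0: "0 \<notin> set w" "0 \<notin> set (w @ u)" using pos_words assms by auto
  note [measurable] = cylinder_borel[OF 0(1)] cylinder_borel[OF 0(2)]
  have sub: "cylinder u \<subseteq> {0..1}"
    using word_map_unit_interval[OF assms(2)] by (auto simp: cylinder_def)
  have "cylinder (w @ u) \<subseteq> cylinder w"
    using sub unfolding cylinder_append by (auto simp: cylinder_def)
  then have "emeasure \<mu> (cylinder (w @ u))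
      = (\<integral>\<^sup>+ x. indicator (cylinder w) x * indicator (cylinder (w @ u)) x \<partial>\<mu>)"
    using 0 by (simp add: Int_absorb1 flip: indicator_inter_arith)
  also have "\<dots> = (\<integral>\<^sup>+ x. ennreal (denom w x powr (-2 * \<delta>)) *
      indicator (cylinder (w @ u)) (word_map w x) \<partial>\<mu>)"
    by (rule nn_integral_word[OF assms(1)]) measurable
  also have "\<dots> = (\<integral>\<^sup>+ x. ennreal (denom w x powr (-2 * \<delta>)) * indicator (cylinder u) x \<partial>\<mu>)"
    using AE_unit_interval
  proof (intro nn_integral_cong_AE, eventually_elim)
    fix x :: real assume x: "x \<in> {0<..<1}"
    have "word_map w x \<in> cylinder (w @ u) \<longleftrightarrow> x \<in> cylinder u"
    proof
      assume "word_map w x \<in> cylinder (w @ u)"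
      then obtain y where y: "y \<in> cylinder u" "word_map w x = word_map w y"
        unfolding cylinder_append by auto
      then have "y > -1" using sub by force
      with word_map_inj[OF 0(1) _ _ y(2)] x y show "x \<in> cylinder u" by auto
    qed (auto simp: cylinder_append)
    then show "ennreal (denom w x powr (-2 * \<delta>)) * indicator (cylinder (w @ u)) (word_map w x)
      = ennreal (denom w x powr (-2 * \<delta>)) * indicator (cylinder u) x"
      by (simp add: indicator_def)
  qed
  finally show ?thesis .
qed

lemma limit_set_cylinder:
  assumes "0 \<notin> set w" "y \<in> cylinder w" "y \<in> limit_set E"
  shows "set w \<subseteq> E"
  using limit_set_word_map[OF zero_notin assms(1)] assms(2,3) unfolding cylinder_def by blast

text \<open>Both measures are integrals over the same cylinder of \<open>u\<close>, with weights
  given by \<open>denom v\<close> and \<open>denom w\<close>. These differ by at most 27 = 3 * 9: a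
  factor 3 for moving the argument from 0 to x and 9 for the change of word. If \<open>v\<close>
  uses a letter outside \<open>E\<close>, its cylinder misses the limit set and is null.\<close>

lemma emeasure_cylinder_comparable:
  assumes "set w \<subseteq> E" "0 \<notin> set v" "0 \<notin> set u"
    and "denom v 0 \<le> 9 * denom w 0" "denom w 0 \<le> 9 * denom v 0"
  shows "emeasure \<mu> (cylinder (v @ u)) \<le> ennreal (27 powr \<bar>2 * \<delta>\<bar>) * emeasure \<mu> (cylinder (w @ u))"
proof (cases "set v \<subseteq> E")
  case False
  have "0 \<notin> set (v @ u)" using assms by auto
  have "AE x in \<mu>. x \<notin> cylinder (v @ u)"
    using AE_limit_set
  proof eventually_elim
    fix x assume "x \<in> limit_set E"
    then show "x \<notin> cylinder (v @ u)" using limit_set_cylinder[OF \<open>0 \<notin> set (v @ u)\<close>] False by auto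
  qed
  then have "emeasure \<mu> (cylinder (v @ u)) = 0"
    using cylinder_borel[OF \<open>0 \<notin> set (v @ u)\<close>] by (subst (asm) AE_iff_measurable) auto
  then show ?thesis by simp
next
  case True
  have 0: "0 \<notin> set w" using assms pos_words by auto
  note [measurable] = cylinder_borel[OF assms(3)]
  have "emeasure \<mu> (cylinder (v @ u))
      = (\<integral>\<^sup>+ x. ennreal (denom v x powr (-2 * \<delta>)) * indicator (cylinder u) x \<partial>\<mu>)"
    by (rule emeasure_cylinder_append[OF True assms(3)])
  also have "\<dots> \<le> (\<integral>\<^sup>+ x. ennreal (27 powr \<bar>2 * \<delta>\<bar>) *
      (ennreal (denom w x powr (-2 * \<delta>)) * indicator (cylinder u) x) \<partial>\<mu>)"
    using AE_unit_interval
  proof (intro nn_integral_mono_AE, eventually_elim)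
    fix x :: real assume x: "x \<in> {0<..<1}"
    have p: "denom v 0 \<ge> 1" "denom w 0 \<ge> 1" using assms 0 denom_0_ge_1 by auto
    have b: "denom v 0 \<le> denom v x" "denom v x \<le> 3 * denom v 0"
         "denom w 0 \<le> denom w x" "denom w x \<le> 3 * denom w 0"
      using denom_0_le_denom[of _ x] denom_bounds(2)[of _ x] x assms(2) 0 by auto
    have "denom v x powr (-2 * \<delta>) \<le> 27 powr \<bar>-2 * \<delta>\<bar> * denom w x powr (-2 * \<delta>)"
      using b p assms(4,5) by (intro powr_comparable) linarith+
    then show "ennreal (denom v x powr (-2 * \<delta>)) * indicator (cylinder u) x
      \<le> ennreal (27 powr \<bar>2 * \<delta>\<bar>) * (ennreal (denom w x powr (-2 * \<delta>)) * indicator (cylinder u) x)"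
      unfolding mult.assoc[symmetric]
      by (intro mult_right_mono) (simp_all add: ennreal_mult'[symmetric] ennreal_leI)
  qed
  also have "\<dots> = ennreal (27 powr \<bar>2 * \<delta>\<bar>) * emeasure \<mu> (cylinder (w @ u))"
    by (subst emeasure_cylinder_append[OF assms(1,3)], rule nn_integral_cmult) measurable
  finally show ?thesis .
qed

end

subsection \<open>Comparison on balls\<close>

text \<open>The left side is the length of the cylinder of \<open>b\<close>. If b >= m or b + 1 = m,
  it is controlled by 1/m^2. Otherwise the cylinder of b + 1 separates the two points, and its
  length is at least a third of that of \<open>b\<close>.\<close>

lemma letter_gap:
  fixes b m :: nat and s t :: real
  assumes "b \<noteq> 0" "m \<noteq> 0" "s \<in> {0..1}" "t \<in> {0..1}"
  shows "1 / (real b * (real b + 1)) \<le> 3 * \<bar>1 / (real b + s) - 1 / (real m + t)\<bar>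
    \<or> 1 / (real b * (real b + 1)) \<le> 3 / (real m)\<^sup>2"
proof -
  consider "b \<ge> m" | "b + 1 = m" | "b + 2 \<le> m" by linarith
  then show ?thesis
  proof cases
    case 1
    have "real m * real m \<le> real b * (real b + 1)" using 1 by (intro mult_mono) auto
    then have "1 / (real b * (real b + 1)) \<le> 1 / (real m)\<^sup>2"
      using assms by (intro divide_left_mono) (auto simp: power2_eq_square)
    also have "\<dots> \<le> 3 / (real m)\<^sup>2" by (intro divide_right_mono) auto
    finally show ?thesis by blast
  next
    case 2
    then have "real m = real b + 1" by auto
    then have "1 / (real b * (real b + 1)) \<le> 3 / (real m)\<^sup>2"
      using assms by (simp add: power2_eq_square divide_simps)
    then show ?thesis by blast
  next
    case 3
    have "1 / (real b + 1) \<le> 1 / (real b + s)" "1 / (real m + t) \<le> 1 / (real b + 2)"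
      using assms 3 by (intro divide_left_mono; auto)+
    moreover have "1 / (real b * (real b + 1)) \<le> 3 * (1 / (real b + 1) - 1 / (real b + 2))"
      using assms by (simp add: divide_simps)
    ultimately have "1 / (real b * (real b + 1)) \<le> 3 * \<bar>1 / (real b + s) - 1 / (real m + t)\<bar>"
      by (elim order_trans) (intro mult_left_mono; linarith)
    then show ?thesis by blast
  qed
qed

lemma mem_letter_cylinder:
  assumes "b \<noteq> 0"
  shows "z \<in> cylinder [b] \<longleftrightarrow> z \<in> {1 / (real b + 1)..1 / real b}"
proof
  assume "z \<in> cylinder [b]"
  then obtain s where "s \<in> {0..1}" "z = 1 / (real b + s)" by (auto simp: cylinder_def)
  then show "z \<in> {1 / (real b + 1)..1 / real b}" using assms
    by (auto intro!: divide_left_mono)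
next
  assume z: "z \<in> {1 / (real b + 1)..1 / real b}"
  have "z > 0" using z assms by (auto intro: less_le_trans[rotated])
  then have "1 / z - real b \<in> {0..1}" using z assms by (auto simp: field_simps)
  moreover have "z = 1 / (real b + (1 / z - real b))" by simp
  ultimately show "z \<in> cylinder [b]" unfolding cylinder_def word_map_Cons word_map_Nil image_iff by blast
qed

context conformal_gauss
begin

text \<open>Sibling cylinders may share endpoints; intersecting them with the limit set makes them
  disjoint without losing mass.\<close>

lemma sum_children_le:
  assumes "0 \<notin> set w" "S \<in> sets borel"
  shows "(\<Sum>a. if a \<in> E \<and> cylinder (w @ [a]) \<subseteq> S then emeasure \<mu> (cylinder (w @ [a])) else 0)
    \<le> emeasure \<mu> S"
proof -
  define F where "F a = (if a \<in> E \<and> cylinder (w @ [a]) \<subseteq> S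
    then cylinder (w @ [a]) \<inter> limit_set E else {})" for a
  have 0: "0 \<notin> set (w @ [a])" if "a \<in> E" for a using assms(1) zero_notin that by (cases a) auto
  have F: "F a \<in> sets borel" for a
    using cylinder_borel[OF 0] by (simp add: F_def)
  have "disjoint_family F"
  proof -
    have "a = b" if ab: "a \<in> E" "b \<in> E" and y: "y \<in> cylinder (w @ [a])" "y \<in> cylinder (w @ [b])"
      "y \<in> limit_set E" for a b y
    proof -
      obtain s t where s: "s \<in> {0..1}" "y = word_map (w @ [a]) s"
        and t: "t \<in> {0..1}" "y = word_map (w @ [b]) t"
        using y unfolding cylinder_def by auto
      have "s \<in> limit_set E" "t \<in> limit_set E"
        using limit_set_word_map[OF zero_notin 0[OF ab(1)] s(1)] s(2)
              limit_set_word_map[OF zero_notin 0[OF ab(2)] t(1)] t(2) y(3) by auto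
      then have st: "s \<in> {0<..<1}" "t \<in> {0<..<1}"
        using limit_set_unit_interval[OF zero_notin] by auto
      then have p: "1 / (real a + s) > 0" "1 / (real b + t) > 0" by auto
      have "word_map w (1 / (real a + s)) = word_map w (1 / (real b + t))"
        using s(2) t(2) by (simp add: word_map_append)
      from word_map_inj[OF assms(1) _ _ this] p
      have "1 / (real a + s) = 1 / (real b + t)" by linarith
      from arg_cong[OF this, of inverse] have e: "real a + s = real b + t" by simp
      have "real a < real (b + 1)" "real b < real (a + 1)" using st e by auto
      then show "a = b" unfolding of_nat_less_iff by linarith
    qed
    then show ?thesis by (auto simp: disjoint_family_on_def F_def)
  qed
  then have sum: "(\<Sum>a. emeasure \<mu> (F a)) = emeasure \<mu> (\<Union>a. F a)"
    using F by (intro suminf_emeasure) auto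
  have "emeasure \<mu> (F a) = (if a \<in> E \<and> cylinder (w @ [a]) \<subseteq> S then emeasure \<mu> (cylinder (w @ [a])) else 0)" for a
  proof (cases "a \<in> E \<and> cylinder (w @ [a]) \<subseteq> S")
    case True
    then have "emeasure \<mu> (cylinder (w @ [a]) \<inter> limit_set E) = emeasure \<mu> (cylinder (w @ [a]))"
      using AE_limit_set cylinder_borel[OF 0, of a] by (intro emeasure_eq_AE) auto
    with True show ?thesis by (simp add: F_def)
  qed (auto simp: F_def)
  with sum have "(\<Sum>a. if a \<in> E \<and> cylinder (w @ [a]) \<subseteq> S then emeasure \<mu> (cylinder (w @ [a])) else 0)
      = emeasure \<mu> (\<Union>a. F a)" by simp
  also have "\<dots> \<le> emeasure \<mu> S" using assms(2) by (intro emeasure_mono) (auto simp: F_def split: if_splits)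
  finally show ?thesis .
qed

lemma emeasure_neighbour_children_le:
  assumes "set w \<subseteq> E" "0 \<notin> set v" "G \<subseteq> E"
    and "denom v 0 \<le> 9 * denom w 0" "denom w 0 \<le> 9 * denom v 0"
  shows "emeasure \<mu> (\<Union>b\<in>G. cylinder (v @ [b]))
    \<le> ennreal (27 powr \<bar>2 * \<delta>\<bar>) * (\<Sum>b. if b \<in> G then emeasure \<mu> (cylinder (w @ [b])) else 0)"
proof -
  define F where "F b = (if b \<in> G then cylinder (v @ [b]) else {})" for b
  have 0: "0 \<notin> set [b]" if "b \<in> G" for b using assms(3) zero_notin that by (cases b) auto
  have F: "F b \<in> sets borel" for b
    using cylinder_borel[of "v @ [b]"] 0 assms(2) by (auto simp: F_def)
  have "(\<Union>b\<in>G. cylinder (v @ [b])) = (\<Union>b. F b)" by (auto simp: F_def split: if_splits)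
  then have "emeasure \<mu> (\<Union>b\<in>G. cylinder (v @ [b])) \<le> (\<Sum>b. emeasure \<mu> (F b))"
    using emeasure_subadditive_countably[of F \<mu>] F by auto
  also have "\<dots> \<le> (\<Sum>b. ennreal (27 powr \<bar>2 * \<delta>\<bar>) *
      (if b \<in> G then emeasure \<mu> (cylinder (w @ [b])) else 0))"
    using emeasure_cylinder_comparable[OF assms(1,2) 0 assms(4,5)]
    by (intro suminf_le) (auto simp: F_def)
  also have "\<dots> = ennreal (27 powr \<bar>2 * \<delta>\<bar>) * (\<Sum>b. if b \<in> G then emeasure \<mu> (cylinder (w @ [b])) else 0)"
    by (rule ennreal_suminf_cmult)
  finally show ?thesis .
qed

text \<open>Each limit point of the ball is charged to a letter \<open>b\<close> by pulling it back
  under \<open>w\<close> to a point u near t. According to whether u lies in [0,1], left of it or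
  right of it, the point belongs to a child of \<open>w\<close>, \<open>v\<close> or
  \<open>v'\<close>. In each case the child of \<open>w\<close> with the same letter stays close to
  the centre.\<close>

lemma ball_covered_by_children:
  assumes w: "set w \<subseteq> E" and m: "m \<in> E" "t' \<in> {0..1}" and t: "t = 1 / (real m + t')"
    and small: "1 < 72 * r * (denom (w @ [m]) 0)\<^sup>2"
    and large: "w = [] \<or> 72 * r * (denom w 0)\<^sup>2 \<le> 1" and "r > 0"
    and v: "\<And>u. u \<in> {-1/2..<0} \<Longrightarrow> word_map w u \<in> {0<..<1} \<Longrightarrow> word_map w u = word_map v (- u / (1 + u))"
    and v0: "0 \<notin> set v"
    and v': "\<And>u. u \<in> {1<..2} \<Longrightarrow> word_map w u \<in> {0<..<1} \<Longrightarrow> word_map w u = word_map v' (u - 1)"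
    and v'0: "0 \<notin> set v'"
    and y: "y \<in> limit_set E" "\<bar>y - word_map w t\<bar> < r"
  shows "\<exists>b\<in>E. cylinder (w @ [b]) \<subseteq> ball (word_map w t) (8000 * r) \<and>
    (y \<in> cylinder (w @ [b]) \<or> y \<in> cylinder (v @ [b]) \<or> y \<in> cylinder (v' @ [b]))"
proof -
  let ?q = "denom w 0"
  have 0: "0 \<notin> set w" using w pos_words by auto
  have m0: "m \<noteq> 0" using m(1) zero_notin by metis
  have y01: "y \<in> {0<..<1}" by (rule limit_set_unit_interval[OF zero_notin y(1)])
  have t01: "t \<in> {0..1}" using m0 m(2) by (auto simp: t divide_le_eq)
  \<comment> \<open>\<open>R\<close> is the radius rescaled by the expansion of \<open>w\<close>;
    pulling back turns r into a distance of at most 9 R.\<close>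
  define R where "R = ?q\<^sup>2 * r"
  have q: "?q \<ge> 1" by (rule denom_0_ge_1[OF 0])
  then have q2: "?q\<^sup>2 > 0" by simp
  have R: "R > 0" using q2 \<open>r > 0\<close> by (simp add: R_def)
  \<comment> \<open>Because the scale is crossed when \<open>m\<close> is appended, 1/m^2 is at most
    of order R; 648 = 72 * 3^2.\<close>
  have m2: "1 / (real m)\<^sup>2 < 648 * R"
  proof -
    have "1 / real m \<in> {-1/2..2}" using m0 by (auto simp: divide_le_eq intro: order_trans[of _ 0])
    then have "denom (w @ [m]) 0 \<le> 3 * ?q * real m"
      using denom_bounds(2)[OF 0] by (auto simp: denom_append intro!: mult_right_mono)
    moreover have "denom (w @ [m]) 0 \<ge> 1" using 0 m0 by (intro denom_0_ge_1) auto
    ultimately have "(denom (w @ [m]) 0)\<^sup>2 \<le> (3 * ?q * real m)\<^sup>2" by (intro power_mono) auto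
    then have "72 * r * (denom (w @ [m]) 0)\<^sup>2 \<le> 72 * r * (3 * ?q * real m)\<^sup>2"
      using \<open>r > 0\<close> by (intro mult_left_mono) auto
    with small have "1 < 648 * R * (real m)\<^sup>2" by (simp add: R_def power_mult_distrib mult_ac)
    then show ?thesis using m0 by (simp add: divide_less_eq)
  qed
  \<comment> \<open>The budget 1953 = 3 * 648 + 9 covers the length of a child plus the distance
    from u to t. Applying \<open>w\<close> costs a factor 4, and 4 * 1953 = 7812 < 8000.\<close>
  have near: "cylinder (w @ [b]) \<subseteq> ball (word_map w t) (8000 * r)"
    if "b \<in> E" "\<And>z. z \<in> {1 / (real b + 1)..1 / real b} \<Longrightarrow> \<bar>z - t\<bar> \<le> 1953 * R" for b
  proof
    fix y assume "y \<in> cylinder (w @ [b])"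
    then obtain z where z: "z \<in> cylinder [b]" "y = word_map w z" by (auto simp: cylinder_append)
    have b0: "b \<noteq> 0" using that(1) zero_notin by metis
    then have zi: "z \<in> {1 / (real b + 1)..1 / real b}" using z mem_letter_cylinder by auto
    have "z \<in> {0..1}"
      using z(1) word_map_unit_interval[of "[b]"] b0 by (auto simp: cylinder_def)
    then have "\<bar>word_map w z - word_map w t\<bar> \<le> 4 * \<bar>z - t\<bar> / ?q\<^sup>2"
      using t01 by (intro word_map_expansion(1)[OF 0]) auto
    also have "\<dots> \<le> 4 * (1953 * R) / ?q\<^sup>2" using that(2)[OF zi] by (intro divide_right_mono) auto
    also have "\<dots> = 7812 * r" using q2 by (simp add: R_def)
    also have "\<dots> < 8000 * r" using \<open>r > 0\<close> by simp
    finally show "y \<in> ball (word_map w t) (8000 * r)" by (simp add: z dist_real_def abs_minus_commute)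
  qed
  show ?thesis
  proof (cases "72 * R \<le> 1")
    case False
    \<comment> \<open>A large R occurs only at n = 0. Then 1953 R exceeds 1, so every first-level
      cylinder fits.\<close>
    then have w_Nil: "w = []" using large by (auto simp: R_def mult_ac)
    obtain b y' where b: "b \<in> E" "y' \<in> limit_set E" "y = 1 / (real b + y')"
      using limit_setE[OF zero_notin y(1)] .
    have b0: "b \<noteq> 0" using b(1) zero_notin by metis
    have ycyl: "y \<in> cylinder [b]"
      using limit_set_unit_interval[OF zero_notin b(2)] b(3) by (auto simp: cylinder_def image_iff)
    have "\<bar>z - t\<bar> \<le> 1953 * R" if "z \<in> {1 / (real b + 1)..1 / real b}" for z
    proof -
      have "z \<in> cylinder [b]" using that b0 mem_letter_cylinder by blast
      then have "z \<in> {0..1}"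
        using word_map_unit_interval[of "[b]"] b0 by (auto simp: cylinder_def)
      then have "\<bar>z - t\<bar> \<le> 1" using t01 by auto
      then show ?thesis using False by linarith
    qed
    from near[OF b(1) this] have "cylinder (w @ [b]) \<subseteq> ball (word_map w t) (8000 * r)" .
    then show ?thesis using b(1) w_Nil ycyl by auto
  next
    case True
    then have "72 * r \<le> 1 / ?q\<^sup>2" using q2 by (simp add: R_def field_simps)
    from word_map_covers_ball[OF 0 t01 y(2) this] obtain u
      where u: "\<bar>u - t\<bar> < 1/8" "\<bar>u - t\<bar> \<le> 9 * R" "y = word_map w u"
      unfolding R_def mult.assoc by blast
    consider "u \<in> {0..1}" | "u < 0" | "u > 1" by (metis atLeastAtMost_iff not_less)
    then show ?thesis
    proof cases
      case 1
      then have "u \<in> limit_set E" using limit_set_word_map[OF zero_notin 0] y(1) u(3) by blast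
      then obtain b u' where b: "b \<in> E" "u' \<in> limit_set E" "u = 1 / (real b + u')"
        using limit_setE[OF zero_notin] by blast
      have b0: "b \<noteq> 0" using b(1) zero_notin by metis
      have u': "u' \<in> {0..1}" using limit_set_unit_interval[OF zero_notin b(2)] by auto
      have ucyl: "u \<in> cylinder [b]" using u' b(3) by (auto simp: cylinder_def)
      have gap: "1 / (real b * (real b + 1)) \<le> 1944 * R"
      proof -
        have "\<bar>u - t\<bar> \<le> 648 * R" using u(2) by (rule order_trans) (use R in simp)
        then have "3 * \<bar>u - t\<bar> \<le> 1944 * R" by simp
        moreover have "3 / (real m)\<^sup>2 \<le> 1944 * R" using m2 by linarith
        ultimately show ?thesis
          using letter_gap[OF b0 m0 u' m(2)] order_trans unfolding b(3)[symmetric] t[symmetric] by blast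
      qed
      have "1 / real b - 1 / (real b + 1) = 1 / (real b * (real b + 1))"
        using b0 by (simp add: field_simps)
      then have "\<bar>z - t\<bar> \<le> 1953 * R" if "z \<in> {1 / (real b + 1)..1 / real b}" for z
        using that ucyl[unfolded mem_letter_cylinder[OF b0]] gap u(2) unfolding atLeastAtMost_iff
        by linarith
      then have "cylinder (w @ [b]) \<subseteq> ball (word_map w t) (8000 * r)" by (rule near[OF b(1)])
      moreover have "y \<in> cylinder (w @ [b])" using ucyl u(3) by (simp add: cylinder_append)
      ultimately show ?thesis using b(1) by blast
    next
      case 2
      define s where "s = - u / (1 + u)"
      have ui: "u \<in> {-1/2..<0}" using 2 u(1) t01 by auto
      then have s: "s \<in> {0..1}" by (auto simp: s_def field_simps)
      have ys: "y = word_map v s" using v[OF ui] y01 u(3) by (simp add: s_def)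
      then have "s \<in> limit_set E" using limit_set_word_map[OF zero_notin v0 s] y(1) by blast
      then obtain b s' where b: "b \<in> E" "s' \<in> limit_set E" "s = 1 / (real b + s')"
        using limit_setE[OF zero_notin] by blast
      have b0: "b \<noteq> 0" using b(1) zero_notin by metis
      have s': "s' \<in> {0..1}" using limit_set_unit_interval[OF zero_notin b(2)] by auto
      have scyl: "s \<in> cylinder [b]" using s' b(3) by (auto simp: cylinder_def)
      \<comment> \<open>Left overhang: -u is about 1/b and at most 9 R, so b is large and the child
        of \<open>w\<close> with letter \<open>b\<close> lies near 0. Since t < 9 R as well, the two
        are close.\<close>
      have "- u = s / (1 + s)" using ui by (simp add: s_def field_simps)
      also have "\<dots> = 1 / (1 + real b + s')" using b0 s' unfolding b(3) by (simp add: field_simps)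
      finally have "- u \<ge> 1 / (real b + 2)" using s' by (auto intro!: divide_left_mono)
      moreover have "1 / real b \<le> 3 * (1 / (real b + 2))" using b0 by (simp add: field_simps)
      ultimately have "1 / real b \<le> 27 * R" using u(2) 2 t01 by auto
      moreover have "t \<le> 9 * R" using u(2) 2 by linarith
      ultimately have "\<bar>z - t\<bar> \<le> 1953 * R" if "z \<in> {1 / (real b + 1)..1 / real b}" for z
        using that t01 R scyl[unfolded mem_letter_cylinder[OF b0]]
          divide_nonneg_nonneg[of 1 "real b + 1"] unfolding atLeastAtMost_iff by linarith
      then have "cylinder (w @ [b]) \<subseteq> ball (word_map w t) (8000 * r)" by (rule near[OF b(1)])
      moreover have "y \<in> cylinder (v @ [b])" using scyl ys by (simp add: cylinder_append)
      ultimately show ?thesis using b(1) by blast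
    next
      case 3
      have ui: "u \<in> {1<..2}" "u - 1 \<in> {0..1}" using 3 u(1) t01 by auto
      have ys: "y = word_map v' (u - 1)" using v'[OF ui(1)] y01 u(3) by simp
      then have "u - 1 \<in> limit_set E" using limit_set_word_map[OF zero_notin v'0 ui(2)] y(1) by blast
      then obtain b s' where b: "b \<in> E" "s' \<in> limit_set E" "u - 1 = 1 / (real b + s')"
        using limit_setE[OF zero_notin] by blast
      have b0: "b \<noteq> 0" using b(1) zero_notin by metis
      have s': "s' \<in> {0..1}" using limit_set_unit_interval[OF zero_notin b(2)] by auto
      have scyl: "u - 1 \<in> cylinder [b]" using s' b(3) by (auto simp: cylinder_def)
      \<comment> \<open>Right overhang: u > 1 and |u - t| < 1/8 force t close to 1, hence m = 1.
        Then R > 1/648 and all of [0,1] is within the budget.\<close>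
      have "m = 1"
      proof (rule ccontr)
        assume "m \<noteq> 1"
        with m0 have "real m \<ge> 2" by auto
        then have "t \<le> 1 / 2" unfolding t using m(2) by (intro divide_left_mono) auto
        then show False using 3 u(1) by linarith
      qed
      then have R1: "1 < 648 * R" using m2 by simp
      have "\<bar>z - t\<bar> \<le> 1953 * R" if "z \<in> {1 / (real b + 1)..1 / real b}" for z
      proof -
        have "z \<in> cylinder [b]" using that b0 mem_letter_cylinder by blast
        then have "z \<in> {0..1}"
          using word_map_unit_interval[of "[b]"] b0 by (auto simp: cylinder_def)
        then have "\<bar>z - t\<bar> \<le> 1" using t01 by auto
        then show ?thesis using R1 by linarith
      qed
      then have "cylinder (w @ [b]) \<subseteq> ball (word_map w t) (8000 * r)" by (rule near[OF b(1)])
      moreover have "y \<in> cylinder (v' @ [b])" using scyl ys by (simp add: cylinder_append)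
      ultimately show ?thesis using b(1) by blast
    qed
  qed
qed

section \<open>Assembly of the two-sided estimate\<close>

lemma ball_comparison:
  assumes "\<And>i. \<omega> i \<in> E" "r > 0"
  shows "\<exists>n. cylinder (prefix \<omega> (Suc n)) \<subseteq> ball (coding \<omega>) (8000 * r) \<and>
    M_sum E \<mu> \<omega> n r \<le> emeasure \<mu> (ball (coding \<omega>) r) \<and>
    emeasure \<mu> (ball (coding \<omega>) r) \<le> ennreal (3 * 27 powr \<bar>2 * \<delta>\<bar>) * M_sum E \<mu> \<omega> n (8000 * r)"
proof -
  have \<omega>: "0 \<notin> range \<omega>" using assms(1) zero_notin by (metis imageE)
  obtain n where n: "1 < 72 * r * (denom (prefix \<omega> (Suc n)) 0)\<^sup>2"
    "n = 0 \<or> 72 * r * (denom (prefix \<omega> n) 0)\<^sup>2 \<le> 1"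
    using scale_exists[OF \<omega> assms(2)] .
  define w m where "w = prefix \<omega> n" "m = \<omega> n"
  have wm: "prefix \<omega> (Suc n) = w @ [m]" by (simp add: w_m_def prefix_Suc)
  have wE: "set w \<subseteq> E" "m \<in> E" "set (w @ [m]) \<subseteq> E"
    using assms(1) set_prefix[of \<omega> n] by (auto simp: w_m_def)
  note 0 = pos_words[OF wE(1)] pos_words[OF wE(3)]
  define x where "x = coding \<omega>"
  define t' where "t' = coding (\<lambda>i. \<omega> (i + Suc n))"
  define t where "t = 1 / (real m + t')"
  have x: "x = word_map (w @ [m]) t'"
    unfolding x_def t_def t'_def wm[symmetric] by (rule coding_shift(1)[OF \<omega>])
  then have xt: "x = word_map w t" by (simp add: word_map_append x_def t_def t'_def)
  have "t' \<in> {0<..<1}" unfolding x_def t_def t'_def using \<omega> by (intro coding_shift(2)) auto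
  then have t': "t' \<in> {0..1}" by auto

  have cyl: "cylinder (w @ [m]) \<subseteq> ball x (8000 * r)"
  proof
    fix y assume "y \<in> cylinder (w @ [m])"
    then obtain s where s: "s \<in> {0..1}" "y = word_map (w @ [m]) s" by (auto simp: cylinder_def)
    let ?q = "denom (w @ [m]) 0"
    have "?q \<ge> 1" by (rule denom_0_ge_1[OF 0(2)])
    then have q2: "?q\<^sup>2 > 0" by simp
    have "\<bar>y - x\<bar> \<le> 4 * \<bar>s - t'\<bar> / ?q\<^sup>2"
      unfolding s(2) x using s(1) t' by (intro word_map_expansion(1)[OF 0(2)]) auto
    also have "\<dots> \<le> 4 * 1 / ?q\<^sup>2" using s(1) t' by (intro divide_right_mono) auto
    \<comment> \<open>The choice of n gives 4/q_{n+1}^2 < 288 r.\<close>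
    also have "\<dots> < 8000 * r"
      using n(1) q2 assms(2) unfolding wm by (simp add: divide_less_eq)
    finally show "y \<in> ball x (8000 * r)" by (simp add: dist_real_def abs_minus_commute)
  qed

  obtain v where v: "0 \<notin> set v" "denom v 0 \<le> 9 * denom w 0" "denom w 0 \<le> 9 * denom v 0"
    "\<And>u. u \<in> {-1/2..<0} \<Longrightarrow> word_map w u \<in> {0<..<1} \<Longrightarrow> word_map w u = word_map v (- u / (1 + u))"
    by (rule neighbour_left[OF 0(1)]) (rule that)
  obtain v' where v': "0 \<notin> set v'" "denom v' 0 \<le> 9 * denom w 0" "denom w 0 \<le> 9 * denom v' 0"
    "\<And>u. u \<in> {1<..2} \<Longrightarrow> word_map w u \<in> {0<..<1} \<Longrightarrow> word_map w u = word_map v' (u - 1)"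
    by (rule neighbour_right[OF 0(1)]) (rule that)
  \<comment> \<open>\<open>G\<close> is the index set of \<open>M_sum\<close> at the enlarged
    radius; the same letters are used for \<open>w\<close> and both neighbours.\<close>
  define G where "G = {b \<in> E. cylinder (w @ [b]) \<subseteq> ball x (8000 * r)}"
  define U where "U v = (\<Union>b\<in>G. cylinder (v @ [b]))" for v
  have U_borel: "U v \<in> sets borel" if "0 \<notin> set v" for v
  proof -
    have "0 \<notin> set (v @ [b])" if "b \<in> G" for b
      using \<open>0 \<notin> set v\<close> that zero_notin by (cases b) (auto simp: G_def)
    then show ?thesis unfolding U_def by (intro sets.countable_UN'' cylinder_borel) auto
  qed
  note [measurable] = U_borel[OF 0(1)] U_borel[OF v(1)] U_borel[OF v'(1)]
  let ?K = "ennreal (27 powr \<bar>2 * \<delta>\<bar>)" and ?M = "M_sum E \<mu> \<omega> n (8000 * r)"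
  have M: "?M = (\<Sum>b. if b \<in> G then emeasure \<mu> (cylinder (w @ [b])) else 0)"
    unfolding M_sum_def G_def x_def w_m_def mem_Collect_eq by (rule refl)
  have U_le: "emeasure \<mu> (U v) \<le> ?K * ?M"
    if "0 \<notin> set v" "denom v 0 \<le> 9 * denom w 0" "denom w 0 \<le> 9 * denom v 0" for v
    unfolding U_def M using that wE(1) by (intro emeasure_neighbour_children_le) (auto simp: G_def)

  \<comment> \<open>The word \<open>w\<close> counts as its own neighbour, so the three unions
    satisfy one and the same bound; this produces the factor 3.\<close>
  have self: "denom w 0 \<le> 9 * denom w 0" using denom_0_ge_1[OF 0(1)] by simp
  have "emeasure \<mu> (ball x r) \<le> emeasure \<mu> (U w \<union> U v \<union> U v')"
    using AE_limit_set
  proof (intro emeasure_mono_AE, eventually_elim)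
    fix y assume y: "y \<in> limit_set E"
    show "y \<in> ball x r \<longrightarrow> y \<in> U w \<union> U v \<union> U v'"
    proof
      assume "y \<in> ball x r"
      then have "\<bar>y - word_map w t\<bar> < r" by (simp add: xt dist_real_def abs_minus_commute)
      moreover have "w = [] \<or> 72 * r * (denom w 0)\<^sup>2 \<le> 1" using n(2) by (auto simp: w_m_def prefix_def)
      ultimately obtain b where "b \<in> E" "cylinder (w @ [b]) \<subseteq> ball x (8000 * r)"
        "y \<in> cylinder (w @ [b]) \<or> y \<in> cylinder (v @ [b]) \<or> y \<in> cylinder (v' @ [b])"
        using ball_covered_by_children[OF wE(1,2) t' t_def n(1)[unfolded wm] _ assms(2)
          v(4) v(1) v'(4) v'(1) y] unfolding xt by blast
      then show "y \<in> U w \<union> U v \<union> U v'" by (auto simp: U_def G_def)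
    qed
  qed measurable
  also have "\<dots> \<le> emeasure \<mu> (U w) + emeasure \<mu> (U v) + emeasure \<mu> (U v')"
    by (intro order_trans[OF emeasure_subadditive] add_mono emeasure_subadditive order_refl) measurable
  also have "\<dots> \<le> ?K * ?M + ?K * ?M + ?K * ?M"
    by (intro add_mono U_le 0(1) self v(1-3) v'(1-3))
  also have "\<dots> = (1 + 1 + 1) * ?K * ?M" by (simp only: distrib_right mult_1_left)
  also have "(1 + 1 + 1) * ?K = ennreal (3 * 27 powr \<bar>2 * \<delta>\<bar>)"
    by (subst ennreal_mult') simp_all
  finally have upper: "emeasure \<mu> (ball x r) \<le> ennreal (3 * 27 powr \<bar>2 * \<delta>\<bar>) * ?M" .

  have "M_sum E \<mu> \<omega> n r \<le> emeasure \<mu> (ball x r)"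
    unfolding M_sum_def x_def w_m_def[symmetric] by (intro sum_children_le 0) auto
  with cyl upper show ?thesis unfolding wm[symmetric] x_def by blast
qed

end

theorem theorem3p2:
  fixes E :: "nat set" and \<delta> :: real and \<mu> :: "real measure"
  assumes "E \<subseteq> {1..}" and "E \<noteq> {}"
    and "pressure_zero E \<delta>"
    and "conformal_measure E \<delta> \<mu>"
  shows "\<exists>C \<ge> 1. \<exists>K > 0. \<forall>\<omega>. (\<forall>i. \<omega> i \<in> E) \<longrightarrow> (\<forall>r > 0. \<exists>n.
           cylinder (prefix \<omega> (Suc n)) \<subseteq> ball (coding \<omega>) (C * r) \<and>
           M_sum E \<mu> \<omega> n r \<le> emeasure \<mu> (ball (coding \<omega>) r) \<and>
           emeasure \<mu> (ball (coding \<omega>) r) \<le> ennreal K * M_sum E \<mu> \<omega> n (C * r))"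
proof -
  interpret conformal_gauss E \<delta> \<mu>
    using assms(1,4) by unfold_locales auto
  show ?thesis
    by (intro exI[of _ 8000] exI[of _ "3 * 27 powr \<bar>2 * \<delta>\<bar>"] conjI allI impI ball_comparison) auto
qed

end
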